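(* Let $a$ be an integral closed 2-frieze of width $m\ge 1$ and $b$ an integral closed 2-frieze of width $\ell\ge 1$, and let $c,d\in\mathbb{Z}$ be such that the last non-trivial row of $a$ in columns $c,c+1$ and the first non-trivial row of $b$ in columns $d,d+1$ contain the same pair $x,y$: $$x=a(m,c)=b(1,d),\qquad y=a(m,c+1)=b(1,d+1).$$ Put $$r=a(m-1,c),\quad s=a(m-1,c+1),\quad u=b(2,d),\quad v=b(2,d+1).$$ Gluing the two pairs of columns over the common pair $x,y$ gives an integral closed 2-frieze of width $m+\ell-1$, that is, there is an integral closed 2-frieze $w$ of width $m+\ell-1$ such that, for $\epsilon\in\{0,1\}$, $$w(i,\epsilon)=a(i,c+\epsilon)\ \text{ for } 0\le i\le m,\qquad w(m-1+i,\epsilon)=b(i,d+\epsilon)\ \text{ for } 1\le i\le \ell+1,$$ if and only if $$u\equiv r\equiv 1 \bmod y\qquad\text{and}\qquad v\equiv s\equiv 1 \bmod x .$$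
   Context: A closed 2-frieze of width $m$ is an array $a(r,c)$, with rows $r\in\{0,1,\dots,m+1\}$ (numbered from top to bottom) and columns $c\in\mathbb{Z}$ (numbered from left to right), whose top and bottom rows consist of 1s, i.e. $a(0,c)=a(m+1,c)=1$ for all $c\in\mathbb{Z}$, and which satisfies the local rule $$a(r,c)=a(r,c-1)\,a(r,c+1)-a(r-1,c)\,a(r+1,c)\qquad (1\le r\le m,\ c\in\mathbb{Z}).$$ A closed 2-frieze is integral if all its entries are positive integers. *)

theory Defs
  imports Main "HOL-Number_Theory.Cong"
begin

text \<open>
  An array is a function of the row and the column. Only the rows from 0 to
  \<open>m + 1\<close> of a closed 2-frieze of width \<open>m\<close> are constrained; its
  values in further rows are irrelevant.
\<close>

definition closed_two_frieze :: "nat \<Rightarrow> (nat \<Rightarrow> int \<Rightarrow> 'a::comm_ring_1) \<Rightarrow> bool" where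
  "closed_two_frieze m a \<longleftrightarrow>
     (\<forall>c. a 0 c = 1 \<and> a (m + 1) c = 1) \<and>
     (\<forall>r\<in>{1..m}. \<forall>c. a r c = a r (c - 1) * a r (c + 1) - a (r - 1) c * a (r + 1) c)"

definition integral_closed_two_frieze :: "nat \<Rightarrow> (nat \<Rightarrow> int \<Rightarrow> int) \<Rightarrow> bool" where
  "integral_closed_two_frieze m a \<longleftrightarrow>
     closed_two_frieze m a \<and> (\<forall>r\<in>{0..m + 1}. \<forall>c. a r c > 0)"

end

theory Submission
  imports Defs
begin

text \<open>
  An integral closed 2-frieze of width \<open>m\<close> is an \<open>(m + 4)\<close>-periodic sequence of vectors in
  \<open>\<int>\<^sup>3\<close> whose consecutive triples have determinant 1; its entries are the determinants
  \<open>|p, p + 1, q|\<close> and \<open>|p, q, q + 1|\<close>. The local rules at the pair \<open>x, y\<close> in \<open>a\<close> and \<open>b\<close> give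
  \<open>u \<equiv> r \<equiv> - x\<close> modulo \<open>y\<close> and \<open>v \<equiv> s \<equiv> - y\<close> modulo \<open>x\<close>, so the congruences say that
  \<open>y\<close> divides \<open>x + 1\<close> and \<open>x\<close> divides \<open>y + 1\<close>.

  If the glued array \<open>w\<close> is integral, then row 1 of \<open>w - a\<close> contains the entries \<open>(v - 1) / x\<close> and
  \<open>(u - 1) / y\<close>, which are therefore integers. Conversely, the divisibilities make \<open>x\<close> and \<open>y\<close>
  coprime, so \<open>x y\<close> divides \<open>x + y + 1\<close>. Then, after placing the common vectors of the two polygons
  together and shearing the two outer ones by integral amounts, both polygons generate the same
  lattice, and their union is the polygon of \<open>w\<close>.
\<close>

section \<open>Determinants of integer triples\<close>

fun det3 :: "int \<times> int \<times> int \<Rightarrow> int \<times> int \<times> int \<Rightarrow> int \<times> int \<times> int \<Rightarrow> int" where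
  "det3 (a1, a2, a3) (b1, b2, b3) (c1, c2, c3) =
     a1 * (b2 * c3 - b3 * c2) - a2 * (b1 * c3 - b3 * c1) + a3 * (b1 * c2 - b2 * c1)"

lemma det3_cyclic: "det3 y z x = det3 x y z"
  by (cases x; cases y; cases z) (simp add: algebra_simps)

lemma det3_repeat: "det3 x y x = 0"
  by (cases x; cases y) (simp add: algebra_simps)

text \<open>By Cramer's rule, the coordinates of a vector in the basis \<open>x\<close>,
  \<open>y\<close>, \<open>z\<close> are, up to sign, its determinants with the three pairs of basis
  vectors.\<close>

lemma det3_eqI:
  assumes "det3 x y z = 1"
    and "det3 x y v = det3 x y w" and "det3 y z v = det3 y z w" and "det3 x z v = det3 x z w"
  shows "v = w"
proof -
  have cramer:
    "fst v * det3 x y z = fst x * det3 y z v - fst y * det3 x z v + fst z * det3 x y v"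
    "fst (snd v) * det3 x y z =
       fst (snd x) * det3 y z v - fst (snd y) * det3 x z v + fst (snd z) * det3 x y v"
    "snd (snd v) * det3 x y z =
       snd (snd x) * det3 y z v - snd (snd y) * det3 x z v + snd (snd z) * det3 x y v" for v
    by (cases x; cases y; cases z; cases v; simp add: algebra_simps)+
  show ?thesis
    using cramer[of v] cramer[of w] assms by (auto intro!: prod_eqI)
qed

text \<open>All six determinants contain \<open>q\<close>, so this is the three-term Pluecker
  relation in the plane obtained by dividing out \<open>q\<close>. In
  \<open>det3_plucker_left\<close> the common vector is \<open>p\<close>.\<close>

lemma det3_plucker_right:
  "det3 p p' q * det3 o' q q' = det3 p o' q * det3 p' q q' - det3 p' o' q * det3 p q q'"
  by (cases p; cases p'; cases q; cases o'; cases q'; hypsubst_thin; unfold det3.simps; algebra)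

lemma det3_plucker_left:
  "det3 p q q' * det3 o' p p' = det3 o' p q * det3 p p' q' - det3 p p' q * det3 o' p q'"
  by (cases p; cases p'; cases q; cases o'; cases q'; hypsubst_thin; unfold det3.simps; algebra)

section \<open>Polygons and friezes\<close>

definition unimodular :: "(int \<Rightarrow> int \<times> int \<times> int) \<Rightarrow> bool" where
  "unimodular V \<longleftrightarrow> (\<forall>p. det3 (V p) (V (p + 1)) (V (p + 2)) = 1)"

text \<open>Two steps to the right in a row advance both indices of the determinant by one.\<close>

definition polygon_entry :: "(int \<Rightarrow> int \<times> int \<times> int) \<Rightarrow> nat \<Rightarrow> int \<Rightarrow> int" where
  "polygon_entry V r c =
     (if even (c - int r)
      then let p = (c - int r) div 2 in det3 (V p) (V (p + 1)) (V (p + int r + 2))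
      else let p = (c - int r + 1) div 2 in det3 (V p) (V (p + int r + 1)) (V (p + int r + 2)))"

lemma polygon_entry_even:
  "c = 2 * p + int r \<Longrightarrow> polygon_entry V r c = det3 (V p) (V (p + 1)) (V (p + int r + 2))"
  by (simp add: polygon_entry_def)

lemma polygon_entry_odd:
  "c = 2 * p + int r - 1 \<Longrightarrow>
     polygon_entry V r c = det3 (V p) (V (p + int r + 1)) (V (p + int r + 2))"
  by (simp add: polygon_entry_def Let_def)

lemma polygon_entry_cases:
  obtains (even) p where "c = 2 * p + int r" | (odd) p where "c = 2 * p + int r - 1"
proof (cases "even (c - int r)")
  case True
  then obtain p where "c - int r = 2 * p" by (rule evenE)
  then show thesis by (intro even[of p]) simp
next
  case False
  then obtain p where "c - int r = 2 * p + 1" by (rule oddE)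
  then show thesis by (intro odd[of "p + 1"]) simp
qed

text \<open>The first index \<open>p\<close> depends only on \<open>c - r\<close>. Hence entries in
  different rows can be compared at the same \<open>p\<close>, as needed when \<open>b\<close> sits
  \<open>m - 1\<close> rows lower in the glued array.\<close>

lemma polygon_entry_cong:
  assumes "\<And>p. c = 2 * p + int r \<Longrightarrow>
      det3 (V p) (V (p + 1)) (V (p + int r + 2)) = det3 (V' p) (V' (p + 1)) (V' (p + int r' + 2))"
    and "\<And>p. c = 2 * p + int r - 1 \<Longrightarrow>
      det3 (V p) (V (p + int r + 1)) (V (p + int r + 2)) =
      det3 (V' p) (V' (p + int r' + 1)) (V' (p + int r' + 2))"
    and "c' - int r' = c - int r"
  shows "polygon_entry V r c = polygon_entry V' r' c'"
proof (cases c r rule: polygon_entry_cases)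
  case (even p)
  then have "c' = 2 * p + int r'" using assms(3) by simp
  then show ?thesis using assms(1) even by (simp add: polygon_entry_even)
next
  case (odd p)
  then have "c' = 2 * p + int r' - 1" using assms(3) by simp
  then show ?thesis using assms(2) odd by (simp add: polygon_entry_odd)
qed

lemma polygon_entry_0:
  assumes "unimodular V"
  shows "polygon_entry V 0 c = 1"
  using assms by (cases c "0::nat" rule: polygon_entry_cases)
    (simp_all add: polygon_entry_even polygon_entry_odd unimodular_def)

text \<open>For each parity the local rule is a Pluecker relation in which one factor is the
  determinant of three consecutive vertices, hence 1.\<close>

lemma polygon_entry_rule:
  assumes V: "unimodular V" and r: "r \<ge> 1"
  shows "polygon_entry V r c =
    polygon_entry V r (c - 1) * polygon_entry V r (c + 1)
    - polygon_entry V (r - 1) c * polygon_entry V (r + 1) c"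
proof (cases c r rule: polygon_entry_cases)
  case (even p)
  define q where "q = p + int r + 2"
  have "polygon_entry V r c = det3 (V p) (V (p + 1)) (V q)"
    using even by (simp add: polygon_entry_even q_def)
  moreover have "polygon_entry V r (c - 1) = det3 (V p) (V (q - 1)) (V q)"
    using even by (subst polygon_entry_odd[of _ p]) (simp_all add: q_def algebra_simps)
  moreover have "polygon_entry V r (c + 1) = det3 (V (p + 1)) (V q) (V (q + 1))"
    using even by (subst polygon_entry_odd[of _ "p + 1"]) (simp_all add: q_def algebra_simps)
  moreover have "polygon_entry V (r - 1) c = det3 (V (p + 1)) (V (q - 1)) (V q)"
    using even r by (subst polygon_entry_odd[of _ "p + 1"]) (simp_all add: q_def of_nat_diff algebra_simps)
  moreover have "polygon_entry V (r + 1) c = det3 (V p) (V q) (V (q + 1))"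
    using even by (subst polygon_entry_odd[of _ p]) (simp_all add: q_def algebra_simps)
  moreover have "det3 (V (q - 1)) (V q) (V (q + 1)) = 1"
    using V[unfolded unimodular_def, rule_format, of "q - 1"] by (simp add: add.commute)
  ultimately show ?thesis
    using det3_plucker_right[of "V p" "V (p + 1)" "V q" "V (q - 1)" "V (q + 1)"] by simp
next
  case (odd p)
  define q where "q = p + int r + 1"
  have "polygon_entry V r c = det3 (V p) (V q) (V (q + 1))"
    using odd by (simp add: polygon_entry_odd q_def algebra_simps)
  moreover have "polygon_entry V r (c - 1) = det3 (V (p - 1)) (V p) (V q)"
    using odd by (subst polygon_entry_even[of _ "p - 1"]) (simp_all add: q_def algebra_simps)
  moreover have "polygon_entry V r (c + 1) = det3 (V p) (V (p + 1)) (V (q + 1))"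
    using odd by (subst polygon_entry_even[of _ p]) (simp_all add: q_def algebra_simps)
  moreover have "polygon_entry V (r - 1) c = det3 (V p) (V (p + 1)) (V q)"
    using odd r by (subst polygon_entry_even[of _ p]) (simp_all add: q_def of_nat_diff algebra_simps)
  moreover have "polygon_entry V (r + 1) c = det3 (V (p - 1)) (V p) (V (q + 1))"
    using odd by (subst polygon_entry_even[of _ "p - 1"]) (simp_all add: q_def algebra_simps)
  moreover have "det3 (V (p - 1)) (V p) (V (p + 1)) = 1"
    using V[unfolded unimodular_def, rule_format, of "p - 1"] by (simp add: add.commute)
  ultimately show ?thesis
    using det3_plucker_left[of "V p" "V q" "V (q + 1)" "V (p - 1)" "V (p + 1)"] by simp
qed

text \<open>By periodicity the last vertices involved are predecessors of \<open>V p\<close>, so the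
  determinant is a consecutive triple in cyclic order.\<close>

lemma polygon_entry_closed:
  assumes V: "unimodular V" and per: "\<And>p. V (p + int n + 4) = V p"
  shows "polygon_entry V (n + 1) c = 1"
proof (cases c "n + 1" rule: polygon_entry_cases)
  case (even p)
  have "V (p + int n + 3) = V (p - 1)" using per[of "p - 1"] by (simp add: algebra_simps)
  then have "polygon_entry V (n + 1) c = det3 (V p) (V (p + 1)) (V (p - 1))"
    using even by (simp add: polygon_entry_even algebra_simps)
  then show ?thesis
    using V[unfolded unimodular_def, rule_format, of "p - 1"]
      det3_cyclic[of "V p" "V (p + 1)" "V (p - 1)"] by (simp add: add.commute)
next
  case (odd p)
  have "V (p + int n + 3) = V (p - 1)" "V (p + int n + 2) = V (p - 2)"
    using per[of "p - 1"] per[of "p - 2"] by (simp_all add: algebra_simps)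
  then have "polygon_entry V (n + 1) c = det3 (V p) (V (p - 2)) (V (p - 1))"
    using odd by (simp add: polygon_entry_odd algebra_simps)
  then show ?thesis
    using V[unfolded unimodular_def, rule_format, of "p - 2"]
      det3_cyclic[of "V p" "V (p - 2)" "V (p - 1)"] det3_cyclic[of "V (p - 1)" "V p" "V (p - 2)"]
    by simp
qed

section \<open>Integral friezes from polygons\<close>

lemma integral_closed_two_friezeD:
  assumes "integral_closed_two_frieze m a"
  shows "a 0 c = 1" and "a (m + 1) c = 1"
    and "1 \<le> r \<Longrightarrow> r \<le> m \<Longrightarrow> a r c = a r (c - 1) * a r (c + 1) - a (r - 1) c * a (r + 1) c"
    and "r \<le> m + 1 \<Longrightarrow> a r c > 0"
proof -
  have ends: "\<forall>c. a 0 c = 1 \<and> a (m + 1) c = 1"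
    and rule: "\<forall>r\<in>{1..m}. \<forall>c. a r c = a r (c - 1) * a r (c + 1) - a (r - 1) c * a (r + 1) c"
    and pos: "\<forall>r\<in>{0..m + 1}. \<forall>c. a r c > 0"
    using assms unfolding integral_closed_two_frieze_def closed_two_frieze_def by blast+
  show "a 0 c = 1" "a (m + 1) c = 1" using ends by blast+
  show "a r c = a r (c - 1) * a r (c + 1) - a (r - 1) c * a (r + 1) c" if "1 \<le> r" "r \<le> m"
    by (rule rule[rule_format]) (use that in simp)
  show "a r c > 0" if "r \<le> m + 1"
    using pos that by simp
qed

lemma integral_closed_two_frieze_shift:
  assumes "integral_closed_two_frieze m a"
  shows "integral_closed_two_frieze m (\<lambda>r c. a r (c + k))"
proof -
  note aD = integral_closed_two_friezeD[OF assms]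
  have rule: "a r (c + k) = a r (c - 1 + k) * a r (c + 1 + k) - a (r - 1) (c + k) * a (r + 1) (c + k)"
    if "r \<in> {1..m}" for r c
    using aD(3)[of r "c + k"] that by (simp add: algebra_simps)
  show ?thesis
    unfolding integral_closed_two_frieze_def closed_two_frieze_def
    by (intro conjI ballI allI rule) (use aD(1,2,4) in simp_all)
qed

text \<open>Positivity spreads from two adjacent columns: the local rule writes the product of the
  left and right neighbours as a sum of positive terms.\<close>

lemma integral_closed_two_frieze_of_polygon:
  assumes V: "unimodular V" and per: "\<And>p. V (p + int n + 4) = V p"
    and pos: "\<And>r. r \<le> n + 1 \<Longrightarrow> polygon_entry V r c > 0"
             "\<And>r. r \<le> n + 1 \<Longrightarrow> polygon_entry V r (c + 1) > 0"
  shows "integral_closed_two_frieze n (polygon_entry V)"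
proof -
  note closed = polygon_entry_0[OF V] polygon_entry_closed[OF V per]
  \<comment> \<open>The sign \<open>e\<close> treats the moves to the right and to the left
    together.\<close>
  have step: "polygon_entry V r (k + e) > 0"
    if prev: "\<And>r. r \<le> n + 1 \<Longrightarrow> polygon_entry V r (k - e) > 0"
      "\<And>r. r \<le> n + 1 \<Longrightarrow> polygon_entry V r k > 0"
      and e: "e = 1 \<or> e = -1" and r: "r \<le> n + 1" for k e r
  proof (cases "r = 0 \<or> r = n + 1")
    case True
    then show ?thesis using closed by auto
  next
    case False
    then have "polygon_entry V r k + polygon_entry V (r - 1) k * polygon_entry V (r + 1) k =
        polygon_entry V r (k - e) * polygon_entry V r (k + e)"
      using polygon_entry_rule[OF V, of r k] e by (auto simp: mult.commute)
    moreover have "polygon_entry V r k > 0" "polygon_entry V (r - 1) k > 0"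
      "polygon_entry V (r + 1) k > 0" "polygon_entry V r (k - e) > 0"
      using prev False r by auto
    ultimately show ?thesis
      by (smt (verit) mult_pos_pos zero_less_mult_pos)
  qed
  have "\<forall>r \<le> n + 1. polygon_entry V r k > 0 \<and> polygon_entry V r (k + 1) > 0" for k
  proof (induction k rule: int_induct[of _ c])
    case base
    then show ?case using pos by simp
  next
    case (step1 k)
    then show ?case using step[of "k + 1" 1] by auto
  next
    case (step2 k)
    then show ?case using step[of k "-1"] by auto
  qed
  then show ?thesis
    unfolding integral_closed_two_frieze_def closed_two_frieze_def
    by (intro conjI ballI allI polygon_entry_rule[OF V]) (use closed in auto)
qed

section \<open>Polygons from integral friezes\<close>

lemma int_recursion_exists:
  fixes f g :: "int \<Rightarrow> 's \<Rightarrow> 's"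
  assumes inv: "\<And>k s. f k (g k s) = s"
  shows "\<exists>S. S q = s0 \<and> (\<forall>k. S (k + 1) = f k (S k))"
proof -
  \<comment> \<open>To the left of \<open>q\<close>, the step from \<open>q - n\<close> to
    \<open>q - n - 1\<close> uses \<open>g\<close> at its lower end, the index at which
    \<open>f\<close> must undo it.\<close>
  define S where "S k = (if k \<ge> q then rec_nat s0 (\<lambda>n. f (q + int n)) (nat (k - q))
      else rec_nat s0 (\<lambda>n. g (q - int n - 1)) (nat (q - k)))" for k
  have "S (k + 1) = f k (S k)" for k
  proof (cases "k \<ge> q")
    case True
    then have "nat (k + 1 - q) = Suc (nat (k - q))" by simp
    then show ?thesis using True by (simp add: S_def)
  next
    case False
    then have *: "nat (q - k) = Suc (nat (q - (k + 1)))" by simp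
    have "S k = g k (S (k + 1))"
      using False unfolding S_def * by (cases "k + 1 = q") (auto simp: S_def)
    then show ?thesis using inv by simp
  qed
  then show ?thesis by (intro exI[of _ S]) (simp add: S_def)
qed

text \<open>The polygon solves V(k+3) = \<alpha>(k) V(k+2) - \<beta>(k) V(k+1) + V(k). The
  coefficient 1 of V(k) preserves the determinant of consecutive triples and makes the recurrence
  reversible over the integers; \<open>prev3\<close> solves it for V(k).\<close>

lemma recurrent_polygon_exists:
  fixes \<alpha> \<beta> :: "int \<Rightarrow> int"
  assumes det: "det3 x y z = 1"
  obtains V where "V q = x" "V (q + 1) = y" "V (q + 2) = z" "unimodular V"
    "\<And>p. det3 (V p) (V (p + 1)) (V (p + 3)) = \<alpha> p"
    "\<And>p. det3 (V p) (V (p + 2)) (V (p + 3)) = \<beta> p"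
proof -
  define next3 where "next3 = (\<lambda>k (s :: (int \<times> int \<times> int) \<times> (int \<times> int \<times> int) \<times> int \<times> int \<times> int).
      case s of ((x1, x2, x3), (y1, y2, y3), (z1, z2, z3)) \<Rightarrow> ((y1, y2, y3), (z1, z2, z3),
        (\<alpha> k * z1 - \<beta> k * y1 + x1, \<alpha> k * z2 - \<beta> k * y2 + x2, \<alpha> k * z3 - \<beta> k * y3 + x3)))"
  define prev3 where "prev3 = (\<lambda>k (s :: (int \<times> int \<times> int) \<times> (int \<times> int \<times> int) \<times> int \<times> int \<times> int).
      case s of ((x1, x2, x3), (y1, y2, y3), (z1, z2, z3)) \<Rightarrow>
        ((z1 - \<alpha> k * y1 + \<beta> k * x1, z2 - \<alpha> k * y2 + \<beta> k * x2, z3 - \<alpha> k * y3 + \<beta> k * x3),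
         (x1, x2, x3), (y1, y2, y3)))"
  have "next3 k (prev3 k s) = s" for k s
    by (auto simp: next3_def prev3_def split: prod.splits)
  then obtain S where S: "S q = (x, y, z)" "\<And>k. S (k + 1) = next3 k (S k)"
    using int_recursion_exists[of next3 prev3 q "(x, y, z)"] by blast
  define V where "V k = fst (S k)" for k
  have V1: "V (k + 1) = fst (snd (S k))" for k
    by (simp add: V_def S(2) next3_def split: prod.splits)
  have V2: "V (k + 2) = snd (snd (S k))" for k
    using V1[of "k + 1"] by (auto simp: add.assoc S(2) next3_def split: prod.splits)
  have V3: "V (k + 3) = snd (snd (next3 k (S k)))" for k
    using V2[of "k + 1"] by (simp add: add.assoc S(2))
  have "det3 (fst (S k)) (fst (snd (S k))) (snd (snd (S k))) = 1" for k
  proof (induction k rule: int_induct[of _ q])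
    case base
    then show ?case using det S by simp
  next
    case (step1 k)
    then show ?case
      unfolding S(2) by (auto simp: next3_def algebra_simps split: prod.splits)
  next
    case (step2 k)
    then show ?case
      using S(2)[of "k - 1"] by (auto simp: next3_def algebra_simps split: prod.splits)
  qed
  note dets = this
  show thesis
  proof (rule that)
    show "V q = x" "V (q + 1) = y" "V (q + 2) = z"
      using V1[of q] V2[of q] S(1) by (simp_all add: V_def)
    show "unimodular V"
      using dets by (simp add: unimodular_def V1 V2) (simp add: V_def)
    fix p
    obtain x1 x2 x3 y1 y2 y3 z1 z2 z3 where
      Sp: "S p = ((x1, x2, x3), (y1, y2, y3), (z1, z2, z3))"
      by (metis prod.exhaust_sel)
    note d = dets[of p, unfolded Sp, simplified]
    show "det3 (V p) (V (p + 1)) (V (p + 3)) = \<alpha> p"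
      unfolding V1 V3 unfolding V_def using d by (simp add: next3_def Sp) algebra
    show "det3 (V p) (V (p + 2)) (V (p + 3)) = \<beta> p"
      unfolding V2 V3 unfolding V_def using d by (simp add: next3_def Sp) algebra
  qed
qed

text \<open>Row 1 supplies the coefficients of the recurrence; the local rule then fixes the lower
  rows, because positive entries can be cancelled. The free choice of the initial triple later puts
  two polygons into common coordinates.\<close>

lemma polygon_of_integral_closed_two_frieze:
  assumes a: "integral_closed_two_frieze m a" and m: "m \<ge> 1" and det: "det3 x y z = 1"
  obtains V where "V q = x" "V (q + 1) = y" "V (q + 2) = z" "unimodular V"
    "\<And>p. V (p + int m + 4) = V p" "\<And>r c. r \<le> m + 1 \<Longrightarrow> polygon_entry V r c = a r c"
proof -
  obtain V where V: "V q = x" "V (q + 1) = y" "V (q + 2) = z" "unimodular V"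
    "\<And>p. det3 (V p) (V (p + 1)) (V (p + 3)) = a 1 (2 * p + 1)"
    "\<And>p. det3 (V p) (V (p + 2)) (V (p + 3)) = a 1 (2 * p)"
    by (rule recurrent_polygon_exists[OF det, where q = q and
          \<alpha> = "\<lambda>p. a 1 (2 * p + 1)" and \<beta> = "\<lambda>p. a 1 (2 * p)"], rule that)
  note aD = integral_closed_two_friezeD[OF a]
  have ent: "polygon_entry V r c = a r c" if "r \<le> m + 1" for r c
    using that
  proof (induction r arbitrary: c rule: less_induct)
    case (less r)
    consider "r = 0" | "r = 1" | k where "r = k + 2"
      by (metis One_nat_def add_2_eq_Suc' not0_implies_Suc)
    then show ?case
    proof cases
      case 1
      then show ?thesis using polygon_entry_0[OF V(4)] aD(1) by simp
    next
      case 2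
      show ?thesis
        by (cases c r rule: polygon_entry_cases)
          (use V(5,6) 2 in \<open>simp_all add: polygon_entry_even polygon_entry_odd add.commute\<close>)
    next
      case 3
      have IH: "polygon_entry V (k + 1) e = a (k + 1) e" "polygon_entry V k e = a k e" for e
        using less.IH less.prems 3 by simp_all
      have "a (k + 1) c = a (k + 1) (c - 1) * a (k + 1) (c + 1) - a k c * a (k + 2) c"
        using aD(3)[of "k + 1" c] less.prems 3 by simp
      moreover have "polygon_entry V (k + 1) c =
          polygon_entry V (k + 1) (c - 1) * polygon_entry V (k + 1) (c + 1)
          - polygon_entry V k c * polygon_entry V (k + 2) c"
        using polygon_entry_rule[OF V(4), of "k + 1" c] by simp
      ultimately have "a k c * polygon_entry V (k + 2) c = a k c * a (k + 2) c"
        unfolding IH by linarith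
      then show ?thesis using aD(4)[of k c] less.prems 3 by simp
    qed
  qed
  \<comment> \<open>The polygon satisfies the local rule also in row \<open>m + 1\<close>, which
    consists of 1s, so the row below it vanishes.\<close>
  have zero: "polygon_entry V (m + 2) c = 0" for c
  proof -
    have "1 = 1 * 1 - a m c * polygon_entry V (m + 2) c"
      using polygon_entry_rule[OF V(4), of "m + 1" c] ent[of "m + 1"] ent[of m] aD(2) by simp
    then show ?thesis using aD(4)[of m c] by simp
  qed
  \<comment> \<open>Both vectors are compared in the basis \<open>V p\<close>,
    \<open>V (p + 1)\<close>, \<open>V (p + m + 3)\<close>: two determinants vanish by
    \<open>zero\<close>, and the third is 1 by row \<open>m + 1\<close>.\<close>
  have "V (p + int m + 4) = V p" for p
  proof (rule det3_eqI)
    show d: "det3 (V p) (V (p + 1)) (V (p + int m + 3)) = 1"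
      using ent[of "m + 1" "2 * p + int (m + 1)"] aD(2)
      by (simp add: polygon_entry_even[of _ p] algebra_simps)
    show "det3 (V p) (V (p + 1)) (V (p + int m + 4)) = det3 (V p) (V (p + 1)) (V p)"
      using zero[of "2 * p + int (m + 2)"]
      by (simp add: polygon_entry_even[of _ p] det3_repeat algebra_simps)
    show "det3 (V p) (V (p + int m + 3)) (V (p + int m + 4)) =
        det3 (V p) (V (p + int m + 3)) (V p)"
      using zero[of "2 * p + int (m + 2) - 1"]
      by (simp add: polygon_entry_odd[of _ p] det3_repeat algebra_simps)
    have "det3 (V (p + 1)) (V (p + int m + 3)) (V (p + int m + 4)) = 1"
      using ent[of "m + 1" "2 * (p + 1) + int (m + 1) - 1"] aD(2)
      by (simp add: polygon_entry_odd[of _ "p + 1"] algebra_simps)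
    then show "det3 (V (p + 1)) (V (p + int m + 3)) (V (p + int m + 4)) =
        det3 (V (p + 1)) (V (p + int m + 3)) (V p)"
      using d det3_cyclic[of "V (p + 1)" "V (p + int m + 3)" "V p"] by simp
  qed
  from that[OF V(1-4) this ent] show thesis .
qed

section \<open>Divisibility for a glued frieze\<close>

text \<open>
  The two arrays agree in the triangle spanned by the columns 0 and 1. Along the diagonal just
  outside this triangle the deviation is propagated linearly by the local rule, and its value in
  row 1 is the quotient.
\<close>

lemma dvd_deviation:
  fixes f g :: "nat \<Rightarrow> int \<Rightarrow> int"
  assumes f0: "\<And>c. f 0 c = 1" and g0: "\<And>c. g 0 c = 1"
    and f: "\<And>r c. 1 \<le> r \<Longrightarrow> r \<le> m \<Longrightarrow> f r c = f r (c - 1) * f r (c + 1) - f (r - 1) c * f (r + 1) c"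
    and g: "\<And>r c. 1 \<le> r \<Longrightarrow> r \<le> m \<Longrightarrow> g r c = g r (c - 1) * g r (c + 1) - g (r - 1) c * g (r + 1) c"
    and pos: "\<And>r c. r \<le> m \<Longrightarrow> f r c > 0"
    and agree: "\<And>r. r \<le> m \<Longrightarrow> g r 0 = f r 0" "\<And>r. r \<le> m \<Longrightarrow> g r 1 = f r 1"
  shows "f m 0 dvd g (m + 1) 1 - f (m + 1) 1"
proof -
  define D where "D = g (m + 1) 1 - f (m + 1) 1"
  \<comment> \<open>Multiplying by \<open>f m 0\<close> keeps the invariant free of division. At
    \<open>k = m\<close> the deviation has reached row 1 and the factor \<open>f 0\<close> is
    1.\<close>
  have "(\<forall>r. r + k \<le> m \<longrightarrow> g r (int k) = f r (int k) \<and> g r (int k + 1) = f r (int k + 1)) \<and>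
      (g (m + 1 - k) (int k + 1) - f (m + 1 - k) (int k + 1)) * f m 0 = f (m - k) (int k) * D"
    if "k \<le> m" for k
    using that
  proof (induction k)
    case 0
    then show ?case using agree by (simp add: D_def)
  next
    case (Suc k)
    define q where "q = m - k"
    have q: "q \<ge> 1" "q \<le> m" "m + 1 - k = q + 1" "m - k = q" "m + 1 - Suc k = q" "m - Suc k = q - 1"
      using Suc.prems by (auto simp: q_def)
    have IH: "r \<le> q \<Longrightarrow> g r (int k) = f r (int k)" "r \<le> q \<Longrightarrow> g r (int k + 1) = f r (int k + 1)"
      "(g (q + 1) (int k + 1) - f (q + 1) (int k + 1)) * f m 0 = f q (int k) * D" for r
      using Suc.IH Suc.prems q by auto
    \<comment> \<open>In the difference of the two local rules at column \<open>k + 1\<close>, only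
      the right and the lower neighbour can deviate.\<close>
    have step: "(g r (int k + 2) - f r (int k + 2)) * f r (int k) =
        f (r - 1) (int k + 1) * (g (r + 1) (int k + 1) - f (r + 1) (int k + 1))"
      if "1 \<le> r" "r \<le> q" for r
      using f[of r "int k + 1"] g[of r "int k + 1"] that q IH(1)[of r] IH(2)[of r] IH(2)[of "r - 1"]
      by (simp add: algebra_simps)
    have "g r (int k + 2) = f r (int k + 2)" if "r + 1 \<le> q" for r
    proof (cases "r = 0")
      case True
      then show ?thesis using f0 g0 by simp
    next
      case False
      then have "(g r (int k + 2) - f r (int k + 2)) * f r (int k) = 0"
        using step[of r] IH(2)[of "r + 1"] that by simp
      then show ?thesis using pos[of r "int k"] that q by simp
    qed
    moreover have "(g q (int k + 2) - f q (int k + 2)) * f m 0 = f (q - 1) (int k + 1) * D"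
    proof -
      have "((g q (int k + 2) - f q (int k + 2)) * f q (int k)) * f m 0 =
          f (q - 1) (int k + 1) * (f q (int k) * D)"
        using step[of q] q IH(3) by (metis mult.assoc order_refl)
      then have "f q (int k) * ((g q (int k + 2) - f q (int k + 2)) * f m 0) =
          f q (int k) * (f (q - 1) (int k + 1) * D)"
        by (simp add: ac_simps)
      then show ?thesis using pos[of q "int k"] q by simp
    qed
    moreover have "int (Suc k) + 1 = int k + 2" "int (Suc k) = int k + 1" by simp_all
    moreover have "r + 1 \<le> q" if "r + Suc k \<le> m" for r
      using that by (simp add: q_def)
    ultimately show ?case
      unfolding q using IH(2) by (metis add_leD1)
  qed
  from this[of m] have "(g 1 (int m + 1) - f 1 (int m + 1)) * f m 0 = D"
    using f0 by simp
  then show ?thesis unfolding D_def by (metis dvd_triv_right)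
qed

section \<open>Gluing polygons\<close>

text \<open>
  In the basis \<open>V (m + 2)\<close>, \<open>V (m + 3)\<close>, \<open>V (m + 4)\<close> of the first polygon, the common part of
  both polygons and the vertex \<open>2\<close> of the second one have the coordinates used below. The
  vertex \<open>2\<close> is \<open>((x + y + 1) / (x y), - (x + 1) / y, 1)\<close>.
\<close>

lemma glue_polygons:
  assumes m: "m \<ge> 1" and l: "l \<ge> 1"
    and a: "integral_closed_two_frieze m a" and b: "integral_closed_two_frieze l b"
    and x: "a m (int m) = x" "b 1 1 = x" and y: "a m (int m + 1) = y" "b 1 2 = y"
    and u: "b 2 1 = u" and v: "b 2 2 = v"
    and dvd: "y dvd u - 1" "x dvd v - 1" "y dvd x + 1" "x dvd y + 1"
  obtains V\<^sub>a V\<^sub>b t t' where "unimodular V\<^sub>a" "unimodular V\<^sub>b"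
    "\<And>p. V\<^sub>a (p + int m + 4) = V\<^sub>a p" "\<And>p. V\<^sub>b (p + int l + 4) = V\<^sub>b p"
    "\<And>r c. r \<le> m + 1 \<Longrightarrow> polygon_entry V\<^sub>a r c = a r c"
    "\<And>r c. r \<le> l + 1 \<Longrightarrow> polygon_entry V\<^sub>b r c = b r c"
    "V\<^sub>a (int m + 2) = (1, 0, 0)" "V\<^sub>a (int m + 3) = (0, 1, 0)" "V\<^sub>a 0 = (0, 0, 1)"
    "V\<^sub>a 1 = (1, - x, y)"
    "V\<^sub>b 0 = (- t, t * x, 1 - t * y)" "V\<^sub>b 1 = (1, - x, y)"
    "V\<^sub>b 3 = (1, 0, 0)" "V\<^sub>b 4 = (- t', 1, 0)"
proof -
  note aD = integral_closed_two_friezeD[OF a]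
  note bD = integral_closed_two_friezeD[OF b]
  have pos: "x > 0" "y > 0"
    using aD(4)[of m] x y by auto
  \<comment> \<open>The shears are \<open>V\<^sub>b 0 = V\<^sub>a 0 - t * V\<^sub>b 1\<close> and
    \<open>V\<^sub>b 4 = V\<^sub>a (m + 3) - t' * V\<^sub>b 3\<close>. Their amounts are forced:
    \<open>u\<close> is the determinant of the vertices 0, 3, 4 of \<open>V\<^sub>b\<close>, and
    \<open>v\<close> that of 0, 1, 4.\<close>
  obtain t where t: "1 - u = y * t"
    using dvd(1) by (metis dvd_diff_commute dvdE)
  obtain t' where t': "1 - v = x * t'"
    using dvd(2) by (metis dvd_diff_commute dvdE)
  obtain k where k: "x + 1 = y * k"
    using dvd(3) by (rule dvdE)
  have "coprime x y"
    using dvd(3) by (metis add.commute coprime_add_one_right coprime_commute coprime_divisors dvd_refl)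
  moreover have "x dvd x + y + 1" "y dvd x + y + 1"
    using dvd_add[OF dvd(4) dvd_refl] dvd_add[OF dvd(3) dvd_refl] by (simp_all add: ac_simps)
  ultimately have "x * y dvd x + y + 1"
    by (rule divides_mult[rotated 2])
  then obtain h where h: "x + y + 1 = x * y * h"
    by (rule dvdE)
  \<comment> \<open>With vertex 2 of \<open>V\<^sub>b\<close> equal to \<open>(h, - k, 1)\<close>,
    this identity makes the determinant of the vertices 0, 1, 2 equal to 1.\<close>
  have hk: "x * h = k + 1"
  proof -
    have "y * (x * h) = y * (k + 1)" using h k by (simp add: algebra_simps)
    then show ?thesis using pos by simp
  qed
  obtain V\<^sub>a where "V\<^sub>a (int m + 2) = (1, 0, 0)" "V\<^sub>a (int m + 2 + 1) = (0, 1, 0)"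
    "V\<^sub>a (int m + 2 + 2) = (0, 0, 1)" and Va': "unimodular V\<^sub>a" "\<And>p. V\<^sub>a (p + int m + 4) = V\<^sub>a p"
    "\<And>r c. r \<le> m + 1 \<Longrightarrow> polygon_entry V\<^sub>a r c = a r c"
    by (rule polygon_of_integral_closed_two_frieze[OF a m, where q = "int m + 2" and
          x = "(1, 0, 0)" and y = "(0, 1, 0)" and z = "(0, 0, 1)"], simp, rule that)
  then have Va: "V\<^sub>a (int m + 2) = (1, 0, 0)" "V\<^sub>a (int m + 3) = (0, 1, 0)" "V\<^sub>a (int m + 4) = (0, 0, 1)"
    by (simp_all add: add.assoc)
  note Va = Va Va'
  have Va0: "V\<^sub>a 0 = (0, 0, 1)" using Va(3) Va(5)[of 0] by simp
  \<comment> \<open>The coordinates of \<open>V\<^sub>a 1\<close> are read off from two entries in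
    row \<open>m\<close> and one consecutive triple.\<close>
  have Va1: "V\<^sub>a 1 = (1, - x, y)"
  proof -
    have "det3 (V\<^sub>a 0) (V\<^sub>a 1) (V\<^sub>a (int m + 2)) = x"
      using Va(6)[of m "int m"] x by (simp add: polygon_entry_even[of _ 0])
    moreover have "det3 (V\<^sub>a 1) (V\<^sub>a (int m + 2)) (V\<^sub>a (int m + 3)) = y"
      using Va(6)[of m "int m + 1"] y
      by (simp add: polygon_entry_odd[of _ 1]) (simp add: algebra_simps)
    moreover have "det3 (V\<^sub>a (int m + 3)) (V\<^sub>a 0) (V\<^sub>a 1) = 1"
      using Va(4)[unfolded unimodular_def, rule_format, of "int m + 3"] Va(5)[of 0] Va(5)[of 1]
      by (simp add: algebra_simps)
    ultimately show ?thesis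
      by (cases "V\<^sub>a 1") (simp add: Va0 Va(1,2))
  qed
  have det: "det3 (- t, t * x, 1 - t * y) (1, - x, y) (h, - k, 1) = 1"
  proof -
    have "h * x - k = 1" using hk by (simp add: mult.commute)
    then show ?thesis by simp algebra
  qed
  obtain V\<^sub>b where "V\<^sub>b 0 = (- t, t * x, 1 - t * y)" "V\<^sub>b (0 + 1) = (1, - x, y)"
    "V\<^sub>b (0 + 2) = (h, - k, 1)" and Vb': "unimodular V\<^sub>b" "\<And>p. V\<^sub>b (p + int l + 4) = V\<^sub>b p"
    "\<And>r c. r \<le> l + 1 \<Longrightarrow> polygon_entry V\<^sub>b r c = b r c"
    by (rule polygon_of_integral_closed_two_frieze[OF b l det, where q = 0], rule that)
  then have Vb: "V\<^sub>b 0 = (- t, t * x, 1 - t * y)" "V\<^sub>b 1 = (1, - x, y)" "V\<^sub>b 2 = (h, - k, 1)"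
    by simp_all
  note Vb = Vb Vb'
  have b1: "det3 (V\<^sub>b p) (V\<^sub>b (p + 1)) (V\<^sub>b (p + 3)) = b 1 (2 * p + 1)"
    "det3 (V\<^sub>b p) (V\<^sub>b (p + 2)) (V\<^sub>b (p + 3)) = b 1 (2 * p)" for p
    using Vb(6)[of 1 "2 * p + 1"] Vb(6)[of 1 "2 * p"]
    by (simp_all add: polygon_entry_even[of _ p] polygon_entry_odd[of _ p] algebra_simps)
  note vb = Vb(4)[unfolded unimodular_def, rule_format]
  have Vb3: "V\<^sub>b 3 = (1, 0, 0)"
  proof (rule det3_eqI)
    show "det3 (V\<^sub>b 0) (V\<^sub>b 1) (V\<^sub>b 2) = 1" using vb[of 0] by simp
    show "det3 (V\<^sub>b 0) (V\<^sub>b 1) (V\<^sub>b 3) = det3 (V\<^sub>b 0) (V\<^sub>b 1) (1, 0, 0)"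
      using b1(1)[of 0] x Vb by (simp add: algebra_simps)
    show "det3 (V\<^sub>b 1) (V\<^sub>b 2) (V\<^sub>b 3) = det3 (V\<^sub>b 1) (V\<^sub>b 2) (1, 0, 0)"
      using vb[of 1] k Vb by (simp add: algebra_simps)
    \<comment> \<open>The entry to the left of the pair comes from the local rule at
      \<open>b 1 1\<close>; below, \<open>b 1 3\<close> comes likewise from the rule at
      \<open>b 1 2\<close>.\<close>
    have "b 1 0 * y = x + u"
      using bD(3)[of 1 1] bD(1) l x y u by (simp add: numeral_2_eq_2)
    also have "\<dots> = (k - t) * y" using k t by (simp add: algebra_simps)
    finally have "b 1 0 = k - t" using pos by simp
    then show "det3 (V\<^sub>b 0) (V\<^sub>b 2) (V\<^sub>b 3) = det3 (V\<^sub>b 0) (V\<^sub>b 2) (1, 0, 0)"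
      using b1(2)[of 0] Vb arg_cong[OF k, of "\<lambda>z. t * z"] by (simp add: algebra_simps)
  qed
  have Vb4: "V\<^sub>b 4 = (- t', 1, 0)"
  proof (rule det3_eqI)
    show "det3 (V\<^sub>b 1) (V\<^sub>b 2) (V\<^sub>b 3) = 1" using vb[of 1] by simp
    have "x * b 1 3 = y + v"
      using bD(3)[of 1 2] bD(1) l x y v by (simp add: numeral_2_eq_2)
    also have "\<dots> = x * (y * h - 1 - t')" using h t' by (simp add: algebra_simps)
    finally have "b 1 3 = y * h - 1 - t'" using pos by simp
    then show "det3 (V\<^sub>b 1) (V\<^sub>b 2) (V\<^sub>b 4) = det3 (V\<^sub>b 1) (V\<^sub>b 2) (- t', 1, 0)"
      using b1(1)[of 1] Vb arg_cong[OF k, of "\<lambda>z. t' * z"] by (simp add: algebra_simps)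
    show "det3 (V\<^sub>b 2) (V\<^sub>b 3) (V\<^sub>b 4) = det3 (V\<^sub>b 2) (V\<^sub>b 3) (- t', 1, 0)"
      using vb[of 2] Vb Vb3 by simp
    show "det3 (V\<^sub>b 1) (V\<^sub>b 3) (V\<^sub>b 4) = det3 (V\<^sub>b 1) (V\<^sub>b 3) (- t', 1, 0)"
      using b1(2)[of 1] y Vb Vb3 by simp
  qed
  show thesis
    by (rule that[OF Va(4) Vb(4) Va(5) Vb(5) Va(6) Vb(6) Va(1,2) Va0 Va1 Vb(1,2) Vb3 Vb4])
qed

text \<open>The columns are normalised so that the vertices 0 and 1 of both polygons correspond. The
  glued polygon follows \<open>V\<^sub>a\<close> from 1 to \<open>m + 2\<close>, then
  \<open>V\<^sub>b\<close> from 4 to \<open>l + 4\<close>; the sheared \<open>V\<^sub>b 0\<close>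
  and \<open>V\<^sub>b 4\<close> replace \<open>V\<^sub>a 0\<close> and
  \<open>V\<^sub>a (m + 3)\<close>.\<close>

lemma glued_frieze_exists:
  assumes m: "m \<ge> 1" and l: "l \<ge> 1"
    and a: "integral_closed_two_frieze m a" and b: "integral_closed_two_frieze l b"
    and x: "a m (int m) = x" "b 1 1 = x" and y: "a m (int m + 1) = y" "b 1 2 = y"
    and dvd: "y dvd b 2 1 - 1" "x dvd b 2 2 - 1" "y dvd x + 1" "x dvd y + 1"
  obtains w where "integral_closed_two_frieze (m + l - 1) w"
    "\<And>\<epsilon> i. \<epsilon> \<in> {0, 1} \<Longrightarrow> i \<le> m \<Longrightarrow> w i (int m + \<epsilon>) = a i (int m + \<epsilon>)"
    "\<And>\<epsilon> i. \<epsilon> \<in> {0, 1} \<Longrightarrow> 1 \<le> i \<Longrightarrow> i \<le> l + 1 \<Longrightarrow> w (m - 1 + i) (int m + \<epsilon>) = b i (1 + \<epsilon>)"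
proof -
  obtain V\<^sub>a V\<^sub>b t t' where Va: "unimodular V\<^sub>a" and Vb: "unimodular V\<^sub>b"
    and pa: "\<And>p. V\<^sub>a (p + int m + 4) = V\<^sub>a p" and pb: "\<And>p. V\<^sub>b (p + int l + 4) = V\<^sub>b p"
    and ea: "\<And>r c. r \<le> m + 1 \<Longrightarrow> polygon_entry V\<^sub>a r c = a r c"
    and eb: "\<And>r c. r \<le> l + 1 \<Longrightarrow> polygon_entry V\<^sub>b r c = b r c"
    and co: "V\<^sub>a (int m + 2) = (1, 0, 0)" "V\<^sub>a (int m + 3) = (0, 1, 0)" "V\<^sub>a 0 = (0, 0, 1)"
      "V\<^sub>a 1 = (1, - x, y)"
      "V\<^sub>b 0 = (- t, t * x, 1 - t * y)" "V\<^sub>b 1 = (1, - x, y)"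
      "V\<^sub>b 3 = (1, 0, 0)" "V\<^sub>b 4 = (- t', 1, 0)"
    by (rule glue_polygons[OF m l a b x y refl refl dvd], rule that)
  \<comment> \<open>The period of a frieze of width \<open>m + l - 1\<close> is
    \<open>(m + l - 1) + 4\<close>. The representative \<open>j\<close> below runs from 1 to
    \<open>N\<close>.\<close>
  define N where "N = int m + int l + 3"
  define W where "W k = (let j = 1 + (k - 1) mod N in
      if j \<le> int m + 2 then V\<^sub>a j else V\<^sub>b (j - int m + 1))" for k
  have N: "N > 0" by (simp add: N_def)
  have per: "W (k + N) = W k" for k
  proof -
    have "(k + N - 1) mod N = (k - 1) mod N"
      by (metis add_diff_eq diff_add_eq mod_add_self2)
    then show ?thesis by (simp add: W_def)
  qed
  have W: "W k = (if k \<le> int m + 2 then V\<^sub>a k else V\<^sub>b (k - int m + 1))" if "1 \<le> k" "k \<le> N" for k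
    using that by (simp add: W_def)
  have WA: "W k = V\<^sub>a k" if "1 \<le> k" "k \<le> int m + 2" for k
    using W that by (simp add: N_def)
  \<comment> \<open>The range includes the two common vertices at its ends,
    \<open>V\<^sub>b 3\<close> and \<open>V\<^sub>b 1\<close>.\<close>
  have WB: "W k = V\<^sub>b (k - int m + 1)" if k: "int m + 2 \<le> k" "k \<le> N + 1" for k
  proof -
    consider "k = int m + 2" | "k = N + 1" | "int m + 2 < k" "k \<le> N" using k by linarith
    then show ?thesis
    proof cases
      case 1
      then show ?thesis using WA[of k] co by simp
    next
      case 2
      then have "W k = V\<^sub>b 1" using per[of 1] WA[of 1] co by (simp add: add.commute)
      moreover have "k - int m + 1 = 1 + int l + 4" using 2 by (simp add: N_def)
      ultimately show ?thesis using pb[of 1] by simp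
    next
      case 3
      then show ?thesis using W[of k] m by simp
    qed
  qed
  \<comment> \<open>One period earlier the index offset disappears, since \<open>N - m + 1\<close>
    is the period \<open>l + 4\<close> of \<open>V\<^sub>b\<close>.\<close>
  have WB': "W k = V\<^sub>b k" if "- int l - 1 \<le> k" "k \<le> 1" for k
  proof -
    have "W k = V\<^sub>b (k + N - int m + 1)"
      using WB[of "k + N"] per[of k] that by (simp add: N_def)
    also have "k + N - int m + 1 = k + int l + 4" by (simp add: N_def)
    finally show ?thesis using pb by simp
  qed
  have Wm3: "W (int m + 3) = (- t', 1, 0)" using WB[of "int m + 3"] co by (simp add: N_def)
  have W0: "W 0 = (- t, t * x, 1 - t * y)" using WB'[of 0] co by simp
  have det: "det3 (W k) (W (k + 1)) (W (k + 2)) = 1" if k: "1 \<le> k" "k \<le> N" for k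
  proof -
    \<comment> \<open>Only the triples at \<open>m + 1\<close> and at \<open>N\<close> mix the
      polygons. Each contains a sheared vertex together with the common vertex along which it was
      sheared, so the determinant is unchanged.\<close>
    consider "k \<le> int m" | "k = int m + 1" | "int m + 2 \<le> k" "k \<le> N - 1" | "k = N"
      using k by linarith
    then show ?thesis
    proof cases
      case 1
      then show ?thesis
        using WA[of k] WA[of "k + 1"] WA[of "k + 2"] k Va by (simp add: unimodular_def)
    next
      case 2
      have "det3 (V\<^sub>a (int m + 1)) (1, 0, 0) (0, 1, 0) = 1"
        using Va[unfolded unimodular_def, rule_format, of "int m + 1"] co by (simp add: algebra_simps)
      then show ?thesis
        using WA[of "int m + 1"] WA[of "int m + 2"] Wm3 co 2
        by (cases "V\<^sub>a (int m + 1)") (simp add: algebra_simps)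
    next
      case 3
      then show ?thesis
        using WB[of k] WB[of "k + 1"] WB[of "k + 2"]
          Vb[unfolded unimodular_def, rule_format, of "k - int m + 1"]
        by (simp add: algebra_simps)
    next
      case 4
      have "det3 (0, 0, 1) (1, - x, y) (V\<^sub>a 2) = 1"
        using Va[unfolded unimodular_def, rule_format, of 0] co by simp
      moreover have shear:
        "det3 (- t, t * x, 1 - t * y) (1, - x, y) z = det3 (0, 0, 1) (1, - x, y) z" for z
        by (cases z) (simp add: algebra_simps)
      moreover have "W N = W 0" "W (N + 1) = W 1" "W (N + 2) = W 2"
        using per[of 0] per[of 1] per[of 2] by (simp_all add: add.commute)
      ultimately show ?thesis
        using W0 WA[of 1] WA[of 2] m co 4 shear[of "V\<^sub>a 2"] by simp
    qed
  qed
  have unimod: "unimodular W"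
    unfolding unimodular_def
  proof
    fix k
    define j where "j = 1 + (k - 1) mod N"
    have "W (k + i) = W (j + i)" for i
    proof -
      have "(k + i - 1) mod N = ((k - 1) mod N + i) mod N"
        by (metis add_diff_eq diff_add_eq mod_add_left_eq)
      then have "(k + i - 1) mod N = (j + i - 1) mod N" by (simp add: j_def)
      then show ?thesis by (simp add: W_def)
    qed
    note this[of 0] this[of 1] this[of 2]
    moreover have "1 \<le> j" "j \<le> N"
      using pos_mod_bound[OF N, of "k - 1"] pos_mod_sign[OF N, of "k - 1"] by (auto simp: j_def)
    ultimately show "det3 (W k) (W (k + 1)) (W (k + 2)) = 1"
      using det[of j] by simp
  qed
  \<comment> \<open>Sheared vertices occur only in row \<open>m\<close>, where the entries are
    \<open>x\<close> and \<open>y\<close>; again the shear vector is in the same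
    determinant.\<close>
  have entA: "polygon_entry W i (int m + \<epsilon>) = a i (int m + \<epsilon>)" if \<epsilon>: "\<epsilon> \<in> {0, 1}" and i: "i \<le> m" for \<epsilon> i
  proof -
    have "polygon_entry W i (int m + \<epsilon>) = polygon_entry V\<^sub>a i (int m + \<epsilon>)"
    proof (rule polygon_entry_cong)
      fix p assume p: "int m + \<epsilon> = 2 * p + int i"
      have q: "p + int i + 2 \<le> int m + 2" "p \<ge> 0" using p i \<epsilon> by auto
      show "det3 (W p) (W (p + 1)) (W (p + int i + 2)) =
          det3 (V\<^sub>a p) (V\<^sub>a (p + 1)) (V\<^sub>a (p + int i + 2))"
      proof (cases "p = 0")
        case True
        then have "int i = int m" using p i \<epsilon> by auto
        then show ?thesis
          using True W0 WA[of 1] WA[of "int m + 2"] m co by (simp add: algebra_simps)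
      next
        case False
        then show ?thesis
          using WA[of p] WA[of "p + 1"] WA[of "p + int i + 2"] q by simp
      qed
    next
      fix p assume p: "int m + \<epsilon> = 2 * p + int i - 1"
      have q: "p + int i + 1 \<le> int m + 2" "p \<ge> 1" using p i \<epsilon> by auto
      show "det3 (W p) (W (p + int i + 1)) (W (p + int i + 2)) =
          det3 (V\<^sub>a p) (V\<^sub>a (p + int i + 1)) (V\<^sub>a (p + int i + 2))"
      proof (cases "p + int i + 2 \<le> int m + 2")
        case True
        then show ?thesis
          using WA[of p] WA[of "p + int i + 1"] WA[of "p + int i + 2"] q by simp
      next
        case False
        then have pi: "p + int i = int m + 1" "p = 1" using p i \<epsilon> by auto
        have "W 1 = (1, - x, y)" "W (int m + 2) = (1, 0, 0)"
          using WA[of 1] WA[of "int m + 2"] m co by simp_all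
        moreover have "p + int i + 1 = int m + 2" "p + int i + 2 = int m + 3" using pi by simp_all
        ultimately show ?thesis
          using pi(2) Wm3 co by (simp only:) simp
      qed
    qed simp
    then show ?thesis using ea i by simp
  qed
  \<comment> \<open>The vertices on the left fall under \<open>WB'\<close> and those on the right
    under \<open>WB\<close>; their index offset \<open>m - 1\<close> is exactly the row
    offset.\<close>
  have entB: "polygon_entry W (m - 1 + i) (int m + \<epsilon>) = b i (1 + \<epsilon>)"
    if \<epsilon>: "\<epsilon> \<in> {0, 1}" and i: "1 \<le> i" "i \<le> l + 1" for \<epsilon> i
  proof -
    have mi: "int (m - 1 + i) = int m - 1 + int i" using m by simp
    have "polygon_entry W (m - 1 + i) (int m + \<epsilon>) = polygon_entry V\<^sub>b i (1 + \<epsilon>)"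
    proof (rule polygon_entry_cong)
      fix p assume p: "int m + \<epsilon> = 2 * p + int (m - 1 + i)"
      have q: "p \<le> 0" "- int l - 1 \<le> p" "p + int i \<ge> 1" "p + int i \<le> int l + 2"
        using p i \<epsilon> mi by auto
      show "det3 (W p) (W (p + 1)) (W (p + int (m - 1 + i) + 2)) =
          det3 (V\<^sub>b p) (V\<^sub>b (p + 1)) (V\<^sub>b (p + int i + 2))"
        using WB'[of p] WB'[of "p + 1"] WB[of "p + int (m - 1 + i) + 2"] q
        unfolding mi by (simp add: N_def algebra_simps)
    next
      fix p assume p: "int m + \<epsilon> = 2 * p + int (m - 1 + i) - 1"
      have q: "p \<le> 1" "- int l - 1 \<le> p" "p + int i \<ge> 2" "p + int i \<le> int l + 3"
        using p i \<epsilon> mi by auto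
      show "det3 (W p) (W (p + int (m - 1 + i) + 1)) (W (p + int (m - 1 + i) + 2)) =
          det3 (V\<^sub>b p) (V\<^sub>b (p + int i + 1)) (V\<^sub>b (p + int i + 2))"
        using WB'[of p] WB[of "p + int (m - 1 + i) + 1"] WB[of "p + int (m - 1 + i) + 2"] q
        unfolding mi by (simp add: N_def algebra_simps)
    qed (use m in simp)
    then show ?thesis using eb i by simp
  qed
  have pos: "polygon_entry W r (int m + \<epsilon>) > 0" if \<epsilon>: "\<epsilon> \<in> {0, 1}" and r: "r \<le> m + l - 1 + 1" for \<epsilon> r
  proof (cases "r \<le> m")
    case True
    then show ?thesis
      using entA[OF \<epsilon>] integral_closed_two_friezeD(4)[OF a] by simp
  next
    case False
    then have "r = m - 1 + (r - m + 1)" "1 \<le> r - m + 1" "r - m + 1 \<le> l + 1"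
      using m r by auto
    then show ?thesis
      using entB[OF \<epsilon>, of "r - m + 1"] integral_closed_two_friezeD(4)[OF b, of "r - m + 1"] by simp
  qed
  have "int (m + l - 1) + 4 = N" using m by (simp add: N_def)
  then have "integral_closed_two_frieze (m + l - 1) (polygon_entry W)"
    using unimod per pos[of 0] pos[of 1]
    by (intro integral_closed_two_frieze_of_polygon[where c = "int m"]) (simp_all add: add.assoc)
  then show thesis
    using entA entB by (rule that)
qed

section \<open>The gluing criterion\<close>

theorem theorem4:
  fixes a b :: "nat \<Rightarrow> int \<Rightarrow> int"
    and m l :: nat
    and c d x y r s u v :: int
  assumes "m \<ge> 1" and "l \<ge> 1"
    and "integral_closed_two_frieze m a"
    and "integral_closed_two_frieze l b"
    and "x = a m c" and "x = b 1 d"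
    and "y = a m (c + 1)" and "y = b 1 (d + 1)"
    and "r = a (m - 1) c" and "s = a (m - 1) (c + 1)"
    and "u = b 2 d" and "v = b 2 (d + 1)"
  shows "(\<exists>w. integral_closed_two_frieze (m + l - 1) w \<and>
            (\<forall>\<epsilon>\<in>{0, 1}.
               (\<forall>i\<in>{0..m}. w i \<epsilon> = a i (c + \<epsilon>)) \<and>
               (\<forall>i\<in>{1..l + 1}. w (m - 1 + i) \<epsilon> = b i (d + \<epsilon>))))
         \<longleftrightarrow> [u = r] (mod y) \<and> [r = 1] (mod y) \<and> [v = s] (mod x) \<and> [s = 1] (mod x)"
    (is "?L \<longleftrightarrow> ?R")
proof -
  note m = assms(1) and l = assms(2)
  note aD = integral_closed_two_friezeD[OF assms(3)]
  note bD = integral_closed_two_friezeD[OF assms(4)]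
  \<comment> \<open>The local rule at the pair has a factor 1 from the bottom row of
    \<open>a\<close> or the top row of \<open>b\<close>, which leaves \<open>r\<close>,
    \<open>s\<close>, \<open>u\<close>, \<open>v\<close> linear.\<close>
  have xr: "y dvd x + r"
    using aD(2)[of c] aD(3)[of m c] m assms by (simp add: algebra_simps)
  have ys: "x dvd y + s"
    using aD(2)[of "c + 1"] aD(3)[of m "c + 1"] m assms by (simp add: algebra_simps)
  have xu: "y dvd x + u"
    using bD(1)[of d] bD(3)[of 1 d] l assms by (simp add: numeral_2_eq_2 algebra_simps)
  have yv: "x dvd y + v"
    using bD(1)[of "d + 1"] bD(3)[of 1 "d + 1"] l assms by (simp add: numeral_2_eq_2 algebra_simps)
  have ur: "[u = r] (mod y)" and vs: "[v = s] (mod x)"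
    using dvd_diff[OF xu xr] dvd_diff[OF yv ys] by (simp_all add: cong_iff_dvd_diff)
  show ?thesis
  proof
    assume ?L
    then obtain w where w: "integral_closed_two_frieze (m + l - 1) w"
      and glued: "\<forall>\<epsilon>\<in>{0, 1}. (\<forall>i\<in>{0..m}. w i \<epsilon> = a i (c + \<epsilon>)) \<and>
        (\<forall>i\<in>{1..l + 1}. w (m - 1 + i) \<epsilon> = b i (d + \<epsilon>))"
      by blast
    have wa: "w i \<epsilon> = a i (c + \<epsilon>)" if "\<epsilon> \<in> {0, 1}" "i \<le> m" for \<epsilon> i
      using bspec[OF glued that(1)] that(2) by simp
    have wb: "w (m - 1 + i) \<epsilon> = b i (d + \<epsilon>)" if "\<epsilon> \<in> {0, 1}" "1 \<le> i" "i \<le> l + 1" for \<epsilon> i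
      using bspec[OF glued that(1)] that(2,3) by simp
    note wD = integral_closed_two_friezeD[OF w]
    have wuv: "w (m + 1) 0 = u" "w (m + 1) 1 = v"
      using wb[of 0 2] wb[of 1 2] m l assms by simp_all
    have "a m (c + 0) dvd w (m + 1) 1 - a (m + 1) (c + 1)"
    proof (rule dvd_deviation[where f = "\<lambda>r k. a r (c + k)" and m = m])
      show "a r (c + k) = a r (c + (k - 1)) * a r (c + (k + 1)) - a (r - 1) (c + k) * a (r + 1) (c + k)"
        if "1 \<le> r" "r \<le> m" for r k
        using aD(3)[of r "c + k"] that by (simp add: algebra_simps)
      show "w r k = w r (k - 1) * w r (k + 1) - w (r - 1) k * w (r + 1) k"
        if "1 \<le> r" "r \<le> m" for r k
        by (rule wD(3)) (use that l in simp_all)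
    qed (use aD(1,4) wD(1) wa in simp_all)
    then have v1: "x dvd v - 1" using wuv aD(2) assms by simp
    \<comment> \<open>The local rule is invariant under reflecting the columns; the reflection
      exchanging the two glued columns turns the argument for \<open>v\<close> into one for
      \<open>u\<close>.\<close>
    have "a m (c + 1 - 0) dvd w (m + 1) (1 - 1) - a (m + 1) (c + 1 - 1)"
    proof (rule dvd_deviation[where f = "\<lambda>r k. a r (c + 1 - k)" and g = "\<lambda>r k. w r (1 - k)" and m = m])
      show "a r (c + 1 - k) =
          a r (c + 1 - (k - 1)) * a r (c + 1 - (k + 1)) - a (r - 1) (c + 1 - k) * a (r + 1) (c + 1 - k)"
        if "1 \<le> r" "r \<le> m" for r k
        using aD(3)[of r "c + 1 - k"] that by (simp add: algebra_simps)
      show "w r (1 - k) = w r (1 - (k - 1)) * w r (1 - (k + 1)) - w (r - 1) (1 - k) * w (r + 1) (1 - k)"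
        if "1 \<le> r" "r \<le> m" for r k
        using wD(3)[of r "1 - k"] that l by (simp add: algebra_simps)
    qed (use aD(1,4) wD(1) wa in simp_all)
    then have u1: "y dvd u - 1" using wuv aD(2) assms by simp
    have "[r = 1] (mod y)" "[s = 1] (mod x)"
      using u1 v1 ur vs by (meson cong_iff_dvd_diff cong_sym cong_trans)+
    then show ?R using ur vs by blast
  next
    assume ?R
    then have r1: "y dvd r - 1" and s1: "x dvd s - 1" and u1: "y dvd u - 1" and v1: "x dvd v - 1"
      by (meson cong_iff_dvd_diff cong_trans)+
    have x1: "y dvd x + 1" and y1: "x dvd y + 1"
      using dvd_diff[OF xr r1] dvd_diff[OF ys s1] by simp_all
    obtain w where w: "integral_closed_two_frieze (m + l - 1) w"
      and wa: "\<And>\<epsilon> i. \<epsilon> \<in> {0, 1} \<Longrightarrow> i \<le> m \<Longrightarrow> w i (int m + \<epsilon>) = a i (int m + \<epsilon> + (c - int m))"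
      and wb: "\<And>\<epsilon> i. \<epsilon> \<in> {0, 1} \<Longrightarrow> 1 \<le> i \<Longrightarrow> i \<le> l + 1 \<Longrightarrow>
          w (m - 1 + i) (int m + \<epsilon>) = b i (1 + \<epsilon> + (d - 1))"
      \<comment> \<open>The shifts move the common pair to the columns \<open>m\<close>,
        \<open>m + 1\<close> of \<open>a\<close> and 1, 2 of \<open>b\<close>; afterwards
        \<open>w\<close> is shifted back by \<open>m\<close>.\<close>
      by (rule glued_frieze_exists[OF m l
            integral_closed_two_frieze_shift[OF assms(3), of "c - int m"]
            integral_closed_two_frieze_shift[OF assms(4), of "d - 1"], where x = x and y = y])
        (use assms u1 v1 x1 y1 in \<open>simp_all add: algebra_simps\<close>)
    show ?L
    proof (intro exI conjI ballI)
      show "integral_closed_two_frieze (m + l - 1) (\<lambda>r k. w r (k + int m))"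
        by (rule integral_closed_two_frieze_shift[OF w])
      show "w i (\<epsilon> + int m) = a i (c + \<epsilon>)" if "\<epsilon> \<in> {0, 1}" "i \<in> {0..m}" for \<epsilon> i
        using wa[of \<epsilon> i] that by (simp add: add.commute)
      show "w (m - 1 + i) (\<epsilon> + int m) = b i (d + \<epsilon>)" if "\<epsilon> \<in> {0, 1}" "i \<in> {1..l + 1}" for \<epsilon> i
        using wb[of \<epsilon> i] that by (simp add: add.commute)
    qed
  qed
qed

end
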